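(* Let $x$ be an indeterminate. For all integers $h \geq 2$ and all integers $0 \leq n \leq h$, the coefficient of $z^n$ in the power series expansion about $z=0$ of the rational function $\mathrm{Conv}_{1,h}(x,-z)$ is $$[z^n]\,\mathrm{Conv}_{1,h}(x,-z) = \binom{x+n}{n}.$$
   Context: $x$ is an indeterminate over $\mathbb{Q}$, and $\binom{y}{n} = y(y-1)\cdots(y-n+1)/n!$ for integers $n\ge 0$. For integers $i\ge 1$ define $$c_{x,i}^{(1)} := -\frac{1}{(2i-1)(2i-3)}\bigl(1+2(i-2)i-x\bigr),$$ and define $\mathrm{ab}_{x,i}^{(1)} := -\frac{1}{4(2i-3)^2}(x-i+2)(x+i-1)$ for $i\ge 3$, $\mathrm{ab}_{x,2}^{(1)} := -\frac12 x(x+1)$, and $\mathrm{ab}_{x,i}^{(1)}:=0$ otherwise. Define polynomials in $z$ by $P_{1,0}(x,z)=0$, $P_{1,1}(x,z)=1$, $Q_{1,0}(x,z)=1$, $Q_{1,1}(x,z)=1-c_{x,1}^{(1)}z$, and for $h\ge 2$ $$P_{1,h}(x,z) = (1-c_{x,h}^{(1)}z)P_{1,h-1}(x,z) - \mathrm{ab}_{x,h}^{(1)}z^2P_{1,h-2}(x,z),$$ $$Q_{1,h}(x,z) = (1-c_{x,h}^{(1)}z)Q_{1,h-1}(x,z) - \mathrm{ab}_{x,h}^{(1)}z^2Q_{1,h-2}(x,z).$$ The $h$-th convergent function is $\mathrm{Conv}_{1,h}(x,z) := P_{1,h}(x,z)/Q_{1,h}(x,z)$. Since $Q_{1,h}(x,0)=1$,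 it expands as a power series in $z$ with coefficients in $\mathbb{Q}[x]$. *)

theory Defs
  imports "HOL-Computational_Algebra.Computational_Algebra"
begin

text \<open>
  The indeterminate \<open>x\<close> is the generator of \<open>rat poly\<close>, i.e. of \<open>\<rat>[x]\<close>; polynomials in \<open>z\<close>
  over \<open>\<rat>[x]\<close> have type \<open>rat poly poly\<close>, so a scalar \<open>c\<close> from \<open>\<rat>[x]\<close> acts by \<open>smult c\<close>.
\<close>

abbreviation indet_x :: "rat poly" where
  "indet_x \<equiv> [:0, 1:]"

abbreviation indet_z :: "rat poly poly" where
  "indet_z \<equiv> [:0, 1:]"

definition c1 :: "nat \<Rightarrow> rat poly" where
  "c1 i = smult (- 1 / ((2 * of_nat i - 1) * (2 * of_nat i - 3)))
            (1 + 2 * (of_nat i - 2) * of_nat i - indet_x)"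

definition ab1 :: "nat \<Rightarrow> rat poly" where
  "ab1 i =
    (if i \<ge> 3 then
       smult (- 1 / (4 * (2 * of_nat i - 3)\<^sup>2))
         ((indet_x - of_nat i + 2) * (indet_x + of_nat i - 1))
     else if i = 2 then smult (- 1 / 2) (indet_x * (indet_x + 1))
     else 0)"

fun P1 :: "nat \<Rightarrow> rat poly poly" where
  "P1 0 = 0"
| "P1 (Suc 0) = 1"
| "P1 (Suc (Suc h)) =
     (1 - smult (c1 (Suc (Suc h))) indet_z) * P1 (Suc h)
     - smult (ab1 (Suc (Suc h))) (indet_z\<^sup>2) * P1 h"

fun Q1 :: "nat \<Rightarrow> rat poly poly" where
  "Q1 0 = 1"
| "Q1 (Suc 0) = 1 - smult (c1 1) indet_z"
| "Q1 (Suc (Suc h)) =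
     (1 - smult (c1 (Suc (Suc h))) indet_z) * Q1 (Suc h)
     - smult (ab1 (Suc (Suc h))) (indet_z\<^sup>2) * Q1 h"

text \<open>
  The power series expansion about \<open>z = 0\<close> of \<open>P\<^sub>1\<^sub>,\<^sub>h(x,z) / Q\<^sub>1\<^sub>,\<^sub>h(x,z)\<close>. Division of
  formal power series needs coefficients in a field, hence the passage from \<open>\<rat>[x]\<close> to its
  field of fractions. The divisor is a unit, by \<open>coeff_Q1_0\<close> below.
\<close>

definition Conv1 :: "nat \<Rightarrow> rat poly fract fps" where
  "Conv1 h = fps_of_poly (map_poly to_fract (P1 h)) / fps_of_poly (map_poly to_fract (Q1 h))"

text \<open>This instance makes \<open>gchoose\<close> available in \<open>\<rat>(x)\<close>.\<close>

lemma of_nat_fract: "(of_nat n :: 'a::idom fract) = to_fract (of_nat n)"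
  by (induction n) simp_all

instance fract :: ("{idom, ring_char_0}") field_char_0
  by standard (simp add: inj_on_def of_nat_fract)

lemma coeff_Q1_0: "coeff (Q1 h) 0 = 1"
  by (induction h rule: Q1.induct) (simp_all add: coeff_mult power2_eq_square)

lemma Conv1_mult_Q1:
  "Conv1 h * fps_of_poly (map_poly to_fract (Q1 h)) = fps_of_poly (map_poly to_fract (P1 h))"
proof -
  have "fps_of_poly (map_poly to_fract (Q1 h)) $ 0 \<noteq> 0"
    by (simp add: coeff_map_poly coeff_Q1_0)
  then show ?thesis
    by (simp add: Conv1_def fps_divide_unit mult.assoc inverse_mult_eq_1)
qed

end

theory Submission
  imports Defs
begin

text \<open>
  The series \<open>\<Sum>\<^sub>n binom(x+n, n) (-z)\<^sup>n\<close> is the binomial series \<open>F = (1 + z)\<^bsup>-(x+1)\<^esup>\<close>, so the claim is that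
  the convergent \<open>P\<^sub>h / Q\<^sub>h\<close> agrees with \<open>F\<close> up to order \<open>h\<close>. As for every continued fraction of
  this shape the agreement is in fact up to order \<open>2h - 1\<close>: the convergents are Pade approximants.

  The proof makes the error explicit. The continued fraction arises from Gauss's hypergeometric
  functions
    \<open>g\<^sub>h = \<^sub>2F\<^sub>1(x + h + 1, h + 1; 2h + 1; -z)\<close>,
  for which \<open>g\<^sub>0 = F\<close> and which satisfy the contiguous relation
    \<open>ab\<^bsub>h+3\<^esub> z\<^sup>2 g\<^bsub>h+2\<^esub> = (1 - c\<^bsub>h+2\<^esub> z) g\<^bsub>h+1\<^esub> - g\<^sub>h\<close>.
  The error \<open>P\<^sub>h - F Q\<^sub>h\<close> satisfies the three-term recurrence common to \<open>P\<close> and \<open>Q\<close>, and the contiguous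
  relation says that \<open>-(\<Prod>\<^bsub>2 \<le> i \<le> h+1\<^esub> ab\<^sub>i) z\<^bsup>2h\<^esup> g\<^sub>h\<close> satisfies it too. Comparing the cases \<open>h = 0\<close> and
  \<open>h = 1\<close> gives \<open>convergent_remainder\<close>. Since \<open>Q\<^sub>h\<close> is a unit, \<open>P\<^sub>h / Q\<^sub>h\<close> and \<open>F\<close> then differ by a
  multiple of \<open>z\<^bsup>2h\<^esup>\<close>, and reflecting \<open>z \<mapsto> -z\<close> turns the coefficients of \<open>F\<close> into those of the theorem.

  The contiguous relation is checked coefficientwise: all coefficients involved are rational
  multiples of one hypergeometric coefficient, which leaves an identity between rational functions.
\<close>

section \<open>Hypergeometric coefficients\<close>

definition hyp_coeff :: "'a::field_char_0 \<Rightarrow> 'a \<Rightarrow> 'a \<Rightarrow> nat \<Rightarrow> 'a" where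
  "hyp_coeff a b c k = pochhammer a k * pochhammer b k / (pochhammer c k * fact k)"

lemma hyp_coeff_0: "hyp_coeff a b c 0 = 1"
  by (simp add: hyp_coeff_def)

text \<open>
  The three shift rules below bring hypergeometric coefficients with neighbouring parameters and
  indices to a common one: the first raises the index alone, the second trades an index for a
  simultaneous shift of all parameters, the third shifts the lower parameter.
\<close>

lemma hyp_coeff_Suc:
  "hyp_coeff a b c (Suc k) =
     (a + of_nat k) * (b + of_nat k) / ((c + of_nat k) * (of_nat k + 1)) * hyp_coeff a b c k"
  by (simp add: hyp_coeff_def pochhammer_rec' add.commute mult_ac)

lemma hyp_coeff_Suc_shift:
  "hyp_coeff a b c (Suc k) =
     a * b / (c * (of_nat k + 1)) * hyp_coeff (a + 1) (b + 1) (c + 1) k"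
  by (simp add: hyp_coeff_def pochhammer_rec add.commute mult_ac)

lemma hyp_coeff_lower_shift:
  assumes "pochhammer c (Suc k) \<noteq> 0"
  shows "hyp_coeff a b c k = (c + of_nat k) / c * hyp_coeff a b (c + 1) k"
proof -
  have "c * pochhammer (c + 1) k = (c + of_nat k) * pochhammer c k"
    by (simp flip: pochhammer_rec pochhammer_rec')
  moreover have "c \<noteq> 0" "c + of_nat k \<noteq> 0" "pochhammer c k \<noteq> 0" "pochhammer (c + 1) k \<noteq> 0"
    using assms pochhammer_rec[of c k] pochhammer_rec'[of c k] by auto
  ultimately show ?thesis
    by (simp add: hyp_coeff_def divide_simps)
qed

text \<open>Keeps the lower parameters \<open>2h + 1, \<dots>, 2h + 4\<close> and the denominators they produce away from zero.\<close>

lemma of_nat_plus_pos_nonzero: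
  "j > 0 \<Longrightarrow> numeral n * of_nat h + of_nat j \<noteq> (0::'a::field_char_0)"
  by (metis add_gr_0 of_nat_add of_nat_eq_0_iff of_nat_mult of_nat_numeral less_irrefl)

text \<open>
  The coefficient of \<open>z\<^bsup>k+2\<^esup>\<close> in the contiguous relation, up to the sign \<open>(-1)\<^sup>k\<close>. Every coefficient on
  the right is expressed through the one on the left, \<open>?B\<close>, whose parameters dominate all others.
\<close>

lemma contiguous_relation:
  fixes x :: "'a::field_char_0" and h k :: nat
  defines "N \<equiv> of_nat h :: 'a" and "K \<equiv> of_nat k :: 'a"
  shows "- ((x - N - 1) * (x + N + 2)) / (4 * (2 * N + 3)\<^sup>2) * hyp_coeff (x + N + 3) (N + 3) (2 * N + 5) k
       = hyp_coeff (x + N + 2) (N + 2) (2 * N + 3) (Suc (Suc k))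
         + (x - 1 - 2 * N * (N + 2)) / ((2 * N + 3) * (2 * N + 1))
             * hyp_coeff (x + N + 2) (N + 2) (2 * N + 3) (Suc k)
         - hyp_coeff (x + N + 1) (N + 1) (2 * N + 1) (Suc (Suc k))"
    (is "_ * ?B = ?U2 + _ * ?U1 - ?V")
proof -
  have pos: "2 * N + of_nat j \<noteq> 0" if "j > 0" for j
    unfolding N_def using that by (rule of_nat_plus_pos_nonzero)
  have poch: "pochhammer (2 * N + of_nat j) n \<noteq> 0" if "j > 0" for j n
    using pos[of "j + _"] that by (auto simp: pochhammer_eq_0_iff eq_neg_iff_add_eq_0 add.assoc)
  have nz: "2 * N + 1 \<noteq> 0" "2 * N + 2 \<noteq> 0" "2 * N + 3 \<noteq> 0" "2 * N + 4 \<noteq> 0"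
    "2 * N + 4 + K \<noteq> 0" "K + 1 \<noteq> 0" "K + 2 \<noteq> 0"
    using pos[of 1] pos[of 2] pos[of 3] pos[of 4] pos[of "4 + k"]
      of_nat_neq_0[of k, where 'a = 'a] of_nat_neq_0[of "Suc k", where 'a = 'a]
    by (simp_all add: K_def add_ac)
  \<comment> \<open>Written this way, the factors \<open>N + 1\<close> and \<open>N + 2\<close> of the upper parameters visibly cancel
      against the even factors of the lower ones.\<close>
  have N1: "N + 1 = (2 * N + 2) / 2" "N + 2 = (2 * N + 4) / 2"
    by (simp_all add: field_simps)
  have lower4: "hyp_coeff (x + N + 3) (N + 3) (2 * N + 4) k = (2 * N + 4 + K) / (2 * N + 4) * ?B"
    using hyp_coeff_lower_shift[of "2 * N + 4" k "x + N + 3" "N + 3"] poch[of 4]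
    by (simp add: K_def add.assoc)
  have lower3: "hyp_coeff (x + N + 3) (N + 3) (2 * N + 3) k
      = (2 * N + 3 + K) / (2 * N + 3) * ((2 * N + 4 + K) / (2 * N + 4) * ?B)"
    using hyp_coeff_lower_shift[of "2 * N + 3" k "x + N + 3" "N + 3"] poch[of 3] lower4
    by (simp add: K_def add.assoc)
  have U1: "?U1 = (x + N + 2) * (2 * N + 4 + K) / (2 * (2 * N + 3) * (K + 1)) * ?B"
  proof -
    have "?U1 = (x + N + 2) * (N + 2) / ((2 * N + 3) * (K + 1))
                  * hyp_coeff (x + N + 3) (N + 3) (2 * N + 4) k"
      by (simp add: hyp_coeff_Suc_shift K_def add.assoc)
    then show ?thesis unfolding lower4 N1(2) using nz by (simp add: mult_ac)
  qed
  have U2: "?U2 = (x + N + 3 + K) * (N + 3 + K) * (x + N + 2)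
                    / (2 * (2 * N + 3) * (K + 1) * (K + 2)) * ?B"
  proof -
    have "?U2 = (x + N + 3 + K) * (N + 3 + K) / ((2 * N + 4 + K) * (K + 2)) * ?U1"
      by (subst hyp_coeff_Suc) (simp add: K_def add_ac)
    then show ?thesis unfolding U1 using nz by (simp add: mult_ac)
  qed
  have V: "?V = (x + N + 1) * (x + N + 2) * (2 * N + 3 + K) * (2 * N + 4 + K)
                  / (4 * (2 * N + 1) * (2 * N + 3) * (K + 1) * (K + 2)) * ?B"
  proof -
    have "?V = (x + N + 1) * (N + 1) / ((2 * N + 1) * (K + 2))
                 * ((x + N + 2) * (N + 2) / ((2 * N + 2) * (K + 1))
                    * hyp_coeff (x + N + 3) (N + 3) (2 * N + 3) k)"
      by (simp add: hyp_coeff_Suc_shift K_def add_ac)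
    then show ?thesis unfolding lower3 N1 using nz by (simp add: divide_simps) algebra
  qed
  have key: "- ((x - N - 1) * (x + N + 2)) / (4 * (2 * N + 3)\<^sup>2)
      = (x + N + 3 + K) * (N + 3 + K) * (x + N + 2) / (2 * (2 * N + 3) * (K + 1) * (K + 2))
        + (x - 1 - 2 * N * (N + 2)) / ((2 * N + 3) * (2 * N + 1))
            * ((x + N + 2) * (2 * N + 4 + K) / (2 * (2 * N + 3) * (K + 1)))
        - (x + N + 1) * (x + N + 2) * (2 * N + 3 + K) * (2 * N + 4 + K)
            / (4 * (2 * N + 1) * (2 * N + 3) * (K + 1) * (K + 2))"
    using nz(1,3,6,7) by (simp add: divide_simps) algebra
  show ?thesis
    unfolding U1 U2 V key by (simp only: left_diff_distrib distrib_right mult.assoc)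
qed

section \<open>Remainder series and their three-term recurrence\<close>

text \<open>The hypergeometric function \<open>g\<^sub>h = \<^sub>2F\<^sub>1(x + h + 1, h + 1; 2h + 1; -z)\<close>.\<close>

definition remainder_series :: "'a::field_char_0 \<Rightarrow> nat \<Rightarrow> 'a fps" where
  "remainder_series x h =
     Abs_fps (\<lambda>k. (-1) ^ k * hyp_coeff (x + of_nat h + 1) (of_nat h + 1) (2 * of_nat h + 1) k)"

lemma remainder_series_0: "remainder_series x 0 = fps_binomial (- (x + 1))"
proof (rule fps_ext)
  fix n
  have "pochhammer (1::'a) n = fact n" by (simp add: pochhammer_fact)
  then show "remainder_series x 0 $ n = fps_binomial (- (x + 1)) $ n"
    by (simp add: remainder_series_def hyp_coeff_def gbinomial_pochhammer add.commute)
qed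

text \<open>
  The first step of the recurrence stands apart, because \<open>ab\<^sub>2\<close> is twice what the general formula
  for \<open>ab\<^sub>i\<close> gives at \<open>i = 2\<close>. Here the constant series 1 takes the place of \<open>g\<^bsub>-1\<^esub>\<close>, and
  \<open>x + 1\<close> that of \<open>-c\<^sub>1\<close>.
\<close>

lemma remainder_series_start:
  fixes x :: "'a::field_char_0"
  shows "fps_const (- (x * (x + 1)) / 2) * fps_X\<^sup>2 * remainder_series x 1
       = (1 + fps_const (x + 1) * fps_X) * remainder_series x 0 - 1"
proof (rule fps_ext)
  fix n
  have R0: "remainder_series x 0 $ k = (-1) ^ k * hyp_coeff (x + 1) 1 1 k" for k
    by (simp add: remainder_series_def)
  have R1: "remainder_series x 1 $ k = (-1) ^ k * hyp_coeff (x + 2) 2 3 k" for k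
    by (simp add: remainder_series_def add.assoc)
  consider "n = 0" | "n = 1" | k where "n = Suc (Suc k)"
    by (metis One_nat_def not0_implies_Suc)
  then show "(fps_const (- (x * (x + 1)) / 2) * fps_X\<^sup>2 * remainder_series x 1) $ n
           = ((1 + fps_const (x + 1) * fps_X) * remainder_series x 0 - 1) $ n"
  proof cases
    case 1
    then show ?thesis
      by (simp add: R0 R1 hyp_coeff_0 power2_eq_square)
  next
    case 2
    then show ?thesis
      by (simp add: R0 R1 hyp_coeff_0 hyp_coeff_Suc power2_eq_square distrib_right mult.assoc)
  next
    case 3
    define K B where "K = (of_nat k :: 'a)" and "B = hyp_coeff (x + 2) 2 3 k"
    have nz: "K + 1 \<noteq> 0" "K + 2 \<noteq> 0"
      using of_nat_neq_0[of k, where 'a = 'a] of_nat_neq_0[of "Suc k", where 'a = 'a]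
      by (simp_all add: K_def add_ac)
    have "pochhammer (2 :: 'a) (Suc k) \<noteq> 0"
    proof -
      have "pochhammer (of_nat 2 :: 'a) (Suc k) = of_nat (pochhammer 2 (Suc k))"
        by (rule pochhammer_of_nat)
      also have "\<dots> \<noteq> 0"
        unfolding of_nat_eq_0_iff using pochhammer_pos[of "2 :: nat" "Suc k"] by simp
      finally show ?thesis by simp
    qed
    then have lower: "hyp_coeff (x + 2) 2 2 k = (K + 2) / 2 * B"
      using hyp_coeff_lower_shift[of 2 k "x + 2" 2]
      by (simp add: K_def B_def add.commute)
    have "hyp_coeff (x + 1) 1 1 (Suc k) = (x + 1) / (K + 1) * hyp_coeff (x + 2) 2 2 k"
      by (simp add: hyp_coeff_Suc_shift K_def add.assoc)
    then have U1: "hyp_coeff (x + 1) 1 1 (Suc k) = (x + 1) * (K + 2) / (2 * (K + 1)) * B"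
      unfolding lower by (simp add: mult_ac)
    have U2: "hyp_coeff (x + 1) 1 1 (Suc (Suc k)) = (x + 2 + K) / (K + 2) * hyp_coeff (x + 1) 1 1 (Suc k)"
      using nz by (subst hyp_coeff_Suc) (simp add: K_def add_ac)
    have key: "- (x * (x + 1)) / 2 * B
        = hyp_coeff (x + 1) 1 1 (Suc (Suc k)) - (x + 1) * hyp_coeff (x + 1) 1 1 (Suc k)"
      unfolding U2 U1 using nz by (simp add: divide_simps) algebra
    have "(fps_const (- (x * (x + 1)) / 2) * fps_X\<^sup>2 * remainder_series x 1) $ n
        = (-1) ^ k * (- (x * (x + 1)) / 2 * B)"
      using 3 unfolding power2_eq_square mult.assoc fps_mult_left_const_nth
      by (simp add: R1[unfolded One_nat_def] B_def)
    also have "\<dots> = ((1 + fps_const (x + 1) * fps_X) * remainder_series x 0 - 1) $ n"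
      unfolding key
      using 3 by (simp add: R0 distrib_right distrib_left right_diff_distrib mult.assoc
          mult.left_commute)
    finally show ?thesis .
  qed
qed

text \<open>
  The constants are \<open>ab\<^bsub>h+3\<^esub>\<close> and \<open>c\<^bsub>h+2\<^esub>\<close>. The coefficients of \<open>z\<^sup>k\<close> with \<open>k \<ge> 2\<close> are given by
  \<open>contiguous_relation\<close>; the left-hand side contributes nothing to the first two.
\<close>

lemma remainder_series_recurrence:
  fixes x :: "'a::field_char_0" and h :: nat
  defines "N \<equiv> of_nat h :: 'a"
  shows "fps_const (- ((x - N - 1) * (x + N + 2)) / (4 * (2 * N + 3)\<^sup>2)) * fps_X\<^sup>2
           * remainder_series x (Suc (Suc h))
       = (1 - fps_const ((x - 1 - 2 * N * (N + 2)) / ((2 * N + 3) * (2 * N + 1))) * fps_X)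
           * remainder_series x (Suc h) - remainder_series x h"
    (is "fps_const ?l * _ * ?R2 = (1 - fps_const ?c * _) * ?R1 - ?R0")
proof (rule fps_ext)
  fix n
  define l c where "l = ?l" and "c = ?c"
  have R0: "?R0 $ k = (-1) ^ k * hyp_coeff (x + N + 1) (N + 1) (2 * N + 1) k" for k
    by (simp add: remainder_series_def N_def)
  have R1: "?R1 $ k = (-1) ^ k * hyp_coeff (x + N + 2) (N + 2) (2 * N + 3) k" for k
    by (simp add: remainder_series_def N_def algebra_simps)
  have R2: "?R2 $ k = (-1) ^ k * hyp_coeff (x + N + 3) (N + 3) (2 * N + 5) k" for k
    by (simp add: remainder_series_def N_def algebra_simps)
  have nz: "2 * N + 1 \<noteq> 0" "2 * N + 3 \<noteq> 0"
    unfolding N_def using of_nat_plus_pos_nonzero[of 1 _ h, where 'a = 'a]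
      of_nat_plus_pos_nonzero[of 3 _ h, where 'a = 'a] by simp_all
  consider "n = 0" | "n = 1" | k where "n = Suc (Suc k)"
    by (metis One_nat_def not0_implies_Suc)
  then have "(fps_const l * fps_X\<^sup>2 * ?R2) $ n = ((1 - fps_const c * fps_X) * ?R1 - ?R0) $ n"
  proof cases
    case 1
    then show ?thesis
      by (simp add: R0 R1 hyp_coeff_0 power2_eq_square)
  next
    case 2
    have "- ((x + N + 2) * (N + 2) / (2 * N + 3)) - c + (x + N + 1) * (N + 1) / (2 * N + 1) = 0"
      unfolding c_def using nz by (simp add: divide_simps) algebra
    then show ?thesis
      using 2 by (simp add: R0 R1 hyp_coeff_0 hyp_coeff_Suc power2_eq_square
          left_diff_distrib mult.assoc)
  next
    case 3
    have "(fps_const l * fps_X\<^sup>2 * ?R2) $ n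
        = (-1) ^ k * (l * hyp_coeff (x + N + 3) (N + 3) (2 * N + 5) k)"
      using 3 by (simp add: R2 power2_eq_square mult.assoc)
    also have "\<dots> = ((1 - fps_const c * fps_X) * ?R1 - ?R0) $ n"
      unfolding contiguous_relation[of x h k, folded N_def, folded l_def c_def]
      using 3 by (simp add: R0 R1 left_diff_distrib right_diff_distrib distrib_left mult.assoc
          mult.left_commute)
    finally show ?thesis .
  qed
  then show "(fps_const ?l * fps_X\<^sup>2 * ?R2) $ n = ((1 - fps_const ?c * fps_X) * ?R1 - ?R0) $ n"
    by (simp only: l_def c_def)
qed

section \<open>The parameters of the continued fraction in the fraction field\<close>

text \<open>
  A rational scalar acting on \<open>\<rat>[x]\<close> becomes an honest quotient in \<open>\<rat>(x)\<close>; this moves the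
  constants \<open>c1\<close> and \<open>ab1\<close> into the field where the hypergeometric identities hold.
\<close>

lemma to_fract_smult_neg_recip:
  assumes "d > 0"
  shows "to_fract (smult (- 1 / of_nat d) p) = - to_fract p / (of_nat d :: rat poly fract)"
proof -
  have "of_nat d * smult (- 1 / of_nat d) p = - p"
    using assms by (simp add: of_nat_poly)
  then have "to_fract (of_nat d * smult (- 1 / of_nat d) p) = - to_fract p"
    by simp
  then have "of_nat d * to_fract (smult (- 1 / of_nat d) p) = - to_fract p"
    by (simp only: to_fract_mult Defs.of_nat_fract)
  then show ?thesis
    using assms by (simp add: field_simps)
qed

lemma to_fract_numeral: "to_fract (numeral n) = (numeral n :: 'a::idom fract)"
  using Defs.of_nat_fract[of "numeral n", where 'a = 'a] by simp

lemma to_fract_c1_1: "to_fract (c1 1) = - (to_fract indet_x + 1)"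
proof -
  have "c1 1 = - (indet_x + 1)" by (simp add: c1_def)
  then show ?thesis by (simp only: to_fract_uminus to_fract_add to_fract_1)
qed

lemma to_fract_c1:
  fixes h :: nat
  defines "N \<equiv> of_nat h :: rat poly fract"
  shows "to_fract (c1 (Suc (Suc h))) =
           (to_fract indet_x - 1 - 2 * N * (N + 2)) / ((2 * N + 3) * (2 * N + 1))"
proof -
  define p :: "rat poly" where "p = 1 + 2 * of_nat h * (of_nat h + 2) - indet_x"
  define d where "d = (2 * h + 3) * (2 * h + 1)"
  have "(2 * of_nat (Suc (Suc h)) - 1) * (2 * of_nat (Suc (Suc h)) - 3) = (of_nat d :: rat)"
    by (simp add: d_def algebra_simps)
  moreover have "1 + 2 * (of_nat (Suc (Suc h)) - 2) * of_nat (Suc (Suc h)) - indet_x = p"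
    unfolding p_def by (simp add: algebra_simps)
  ultimately have "c1 (Suc (Suc h)) = smult (- 1 / of_nat d) p"
    by (simp only: c1_def)
  then have "to_fract (c1 (Suc (Suc h))) = - to_fract p / of_nat d"
    using to_fract_smult_neg_recip[of d p] by (simp only: d_def) simp
  moreover have "to_fract p = 1 + 2 * N * (N + 2) - to_fract indet_x"
    unfolding p_def N_def Defs.of_nat_fract
    by (simp only: to_fract_add to_fract_diff to_fract_mult to_fract_1 to_fract_numeral)
  moreover have "of_nat d = (2 * N + 3) * (2 * N + 1)"
    by (simp add: d_def N_def distrib_left)
  ultimately show ?thesis by (simp only: minus_diff_eq diff_diff_eq)
qed

lemma to_fract_ab1_2:
  "to_fract (ab1 2) = - (to_fract indet_x * (to_fract indet_x + 1)) / 2"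
proof -
  have "ab1 2 = smult (- 1 / of_nat 2) (indet_x * (indet_x + 1))" by (simp add: ab1_def)
  then show ?thesis
    by (simp only: to_fract_smult_neg_recip to_fract_add to_fract_mult to_fract_1) simp
qed

lemma to_fract_ab1:
  fixes h :: nat
  defines "N \<equiv> of_nat h :: rat poly fract"
  shows "to_fract (ab1 (h + 3)) =
     - ((to_fract indet_x - N - 1) * (to_fract indet_x + N + 2)) / (4 * (2 * N + 3)\<^sup>2)"
proof -
  define p where "p = (indet_x - of_nat h - 1) * (indet_x + of_nat h + 2)"
  define d where "d = 4 * (2 * h + 3)\<^sup>2"
  have "4 * (2 * of_nat (h + 3) - 3)\<^sup>2 = (of_nat d :: rat)"
    by (simp add: d_def)
  moreover have "(indet_x - of_nat (h + 3) + 2) * (indet_x + of_nat (h + 3) - 1) = p"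
    unfolding p_def by (rule arg_cong2[of _ _ _ _ "(*)"]) simp_all
  ultimately have "ab1 (h + 3) = smult (- 1 / of_nat d) p"
    by (simp only: ab1_def) simp
  then have "to_fract (ab1 (h + 3)) = - to_fract p / of_nat d"
    using to_fract_smult_neg_recip[of d p] by (simp only: d_def) simp
  moreover have "to_fract p = (to_fract indet_x - N - 1) * (to_fract indet_x + N + 2)"
    unfolding p_def N_def Defs.of_nat_fract
    by (simp only: to_fract_add to_fract_diff to_fract_mult to_fract_1 to_fract_numeral)
  moreover have "of_nat d = 4 * (2 * N + 3)\<^sup>2"
    by (simp add: d_def N_def)
  ultimately show ?thesis by (simp only:)
qed

section \<open>Error of the convergents\<close>

abbreviation fps_P :: "nat \<Rightarrow> rat poly fract fps" where
  "fps_P h \<equiv> fps_of_poly (map_poly to_fract (P1 h))"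

abbreviation fps_Q :: "nat \<Rightarrow> rat poly fract fps" where
  "fps_Q h \<equiv> fps_of_poly (map_poly to_fract (Q1 h))"

lemma fps_of_indet_z: "fps_of_poly (map_poly to_fract indet_z) = fps_X"
  by (simp add: map_poly_pCons)

lemma fps_PQ_recurrence:
  defines "c \<equiv> \<lambda>h. to_fract (c1 h)" and "l \<equiv> \<lambda>h. to_fract (ab1 h)"
  shows "fps_P (Suc (Suc h)) = (1 - fps_const (c (Suc (Suc h))) * fps_X) * fps_P (Suc h)
           - fps_const (l (Suc (Suc h))) * fps_X\<^sup>2 * fps_P h"
    and "fps_Q (Suc (Suc h)) = (1 - fps_const (c (Suc (Suc h))) * fps_X) * fps_Q (Suc h)
           - fps_const (l (Suc (Suc h))) * fps_X\<^sup>2 * fps_Q h"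
    and "fps_Q 1 = 1 - fps_const (c 1) * fps_X"
  unfolding c_def l_def
  by (simp_all add: power2_eq_square fps_of_poly_diff fps_of_poly_mult fps_of_poly_smult
      fps_of_indet_z del: mult_pCons_left mult_pCons_right smult_pCons)

text \<open>
  Both sides satisfy the recurrence of \<open>P\<close> and \<open>Q\<close>: the factor \<open>ab\<^bsub>h+2\<^esub>\<close> of the recurrence completes the
  product for \<open>h\<close> to that for \<open>h + 1\<close>, and what remains is \<open>(1 - c\<^bsub>h+2\<^esub> z) g\<^bsub>h+1\<^esub> - g\<^sub>h\<close>.
\<close>

lemma convergent_remainder:
  "fps_P h - remainder_series (to_fract indet_x) 0 * fps_Q h =
     - fps_const (\<Prod>i<h. to_fract (ab1 (i + 2))) * fps_X ^ (2 * h)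
       * remainder_series (to_fract indet_x) h"
    (is "?r h = - fps_const (?L h) * _ * ?R h")
proof (induction h rule: P1.induct)
  case 1
  show ?case by simp
next
  case 2
  have P: "fps_P 1 = 1" by simp
  have "?r 1 = - (fps_const (to_fract (ab1 2)) * fps_X\<^sup>2 * ?R 1)"
    unfolding to_fract_ab1_2 remainder_series_start fps_PQ_recurrence(3) P to_fract_c1_1
      fps_const_neg[symmetric]
    by algebra
  moreover have "(\<Prod>i<1. to_fract (ab1 (i + 2))) = to_fract (ab1 2)" by (simp add: numeral_2_eq_2)
  ultimately show ?case
    by (simp only: One_nat_def[symmetric] mult_1_right mult_minus_left)
next
  case (3 h)
  let ?c = "fps_const (to_fract (c1 (Suc (Suc h))))"
  let ?l = "\<lambda>i. fps_const (to_fract (ab1 i))"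
  have L: "fps_const (?L (Suc h)) = fps_const (?L h) * ?l (Suc (Suc h))"
    "fps_const (?L (Suc (Suc h))) = fps_const (?L (Suc h)) * ?l (h + 3)"
    by (simp_all add: numeral_3_eq_3 flip: fps_const_mult)
  have X: "fps_X ^ (2 * Suc h) = fps_X ^ (2 * h) * (fps_X\<^sup>2 :: rat poly fract fps)"
    "fps_X ^ (2 * Suc (Suc h)) = fps_X ^ (2 * Suc h) * (fps_X\<^sup>2 :: rat poly fract fps)"
    by (simp_all add: power2_eq_square)
  have R: "?l (h + 3) * fps_X\<^sup>2 * ?R (Suc (Suc h)) = (1 - ?c * fps_X) * ?R (Suc h) - ?R h"
    unfolding to_fract_ab1 to_fract_c1 by (rule remainder_series_recurrence)
  have "?r (Suc (Suc h)) = (1 - ?c * fps_X) * ?r (Suc h) - ?l (Suc (Suc h)) * fps_X\<^sup>2 * ?r h"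
  proof -
    have "t * p1 - l * z * p0 - f * (t * q1 - l * z * q0) = t * (p1 - f * q1) - l * z * (p0 - f * q0)"
      for t l z f p0 p1 q0 q1 :: "rat poly fract fps"
      by (simp add: algebra_simps)
    then show ?thesis unfolding fps_PQ_recurrence .
  qed
  also have "\<dots> = - (fps_const (?L (Suc h)) * fps_X ^ (2 * Suc h)
                     * ((1 - ?c * fps_X) * ?R (Suc h) - ?R h))"
  proof -
    have "t * (- (L * l) * (Z * z) * b) - l * z * (- L * Z * a) = - (L * l * (Z * z) * (t * b - a))"
      for t l z L Z a b :: "rat poly fract fps"
      by (simp add: algebra_simps)
    then show ?thesis unfolding 3 X(1) L(1) .
  qed
  also have "\<dots> = - fps_const (?L (Suc (Suc h))) * fps_X ^ (2 * Suc (Suc h)) * ?R (Suc (Suc h))"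
  proof -
    have "- (L * Z * (l * z * g)) = - (L * l) * (Z * z) * g"
      for l z L Z g :: "rat poly fract fps"
      by (simp add: algebra_simps)
    then show ?thesis unfolding X(2) L(2) R[symmetric] .
  qed
  finally show ?case .
qed

text \<open>The bound on \<open>n\<close> is the exponent in the factor \<open>z\<^bsup>2h\<^esup>\<close> of the error, which division by the unit \<open>Q\<^sub>h\<close> preserves.\<close>

lemma Conv1_nth:
  assumes "n < 2 * h"
  shows "Conv1 h $ n = (- (to_fract indet_x + 1)) gchoose n"
proof -
  let ?F = "remainder_series (to_fract indet_x) 0"
  have unit: "fps_Q h $ 0 \<noteq> 0" by (simp add: coeff_map_poly coeff_Q1_0)
  define E where "E = - fps_const (\<Prod>i<h. to_fract (ab1 (i + 2)))
                        * remainder_series (to_fract indet_x) h"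
  have E: "fps_P h - ?F * fps_Q h = fps_X ^ (2 * h) * E"
    unfolding convergent_remainder E_def by (simp only: mult_ac)
  have "(Conv1 h - ?F) * fps_Q h = fps_X ^ (2 * h) * E"
    unfolding E[symmetric] by (simp only: left_diff_distrib Conv1_mult_Q1)
  then have "(Conv1 h - ?F) * (fps_Q h * inverse (fps_Q h))
             = fps_X ^ (2 * h) * (E * inverse (fps_Q h))"
    by (simp only: mult.assoc[symmetric])
  then have "Conv1 h - ?F = fps_X ^ (2 * h) * (E * inverse (fps_Q h))"
    unfolding inverse_mult_eq_1'[OF unit] mult_1_right .
  then have "(Conv1 h - ?F) $ n = 0"
    using assms by (simp only: fps_X_power_mult_nth if_True)
  then show ?thesis by (simp add: remainder_series_0)
qed

theorem theoremI:
  fixes h n :: nat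
  assumes "h \<ge> 2" and "n \<le> h"
  shows "fps_nth (Conv1 h oo (- fps_X)) n = (to_fract indet_x + of_nat n) gchoose n"
proof -
  have "fps_nth (Conv1 h oo (- fps_X)) n = (-1) ^ n * ((- (to_fract indet_x + 1)) gchoose n)"
    using assms Conv1_nth[of n h] by (simp add: fps_compose_uminus')
  also have "\<dots> = (to_fract indet_x + of_nat n) gchoose n"
    by (simp only: gbinomial_minus) (simp add: add_ac)
  finally show ?thesis .
qed

end
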